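(* Let $G$ be a finite simple graph, let $G_1$ be its Barycentric refinement, and let $f=\dim$ be the function on the vertices of $G_1$ assigning to a simplex $x$ of $G$ its dimension. Then the Morse cohomology of the Barycentric Morse system $(G_1,f)$ is the simplicial cohomology of $G$: for every $m\ge0$, the $m$-th Morse cohomology group of $(G_1,f)$ is isomorphic to the simplicial cohomology group $H^m(G)$.
   Context: A $k$-simplex of $G$ is (the vertex set of) a complete subgraph with $k+1$ vertices, $k\ge0$; its dimension is $k$. The Barycentric refinement $G_1$ is the graph whose vertices are the simplices of $G$, two distinct simplices being joined if one is contained in the other. For a vertex $x$ of $G_1$, $S^-_f(x)$ is the subgraph of $G_1$ generated by the neighbors $y$ of $x$ with $f(y)<f(x)$, i.e. by the simplices properly contained in $x$. This is a sphere of dimension $\dim(x)-1$ (the empty graph being the $(-1)$-sphere), so every vertex $x$ of $G_1$ is a critical point of $f$, with Morse index $\dim(x)$. Fix an arbitrary orientation of each simplex of $G$ (no compatibility required); the orientation of the sphere $S^-_f(x)$ is by definition the orientation of the corresponding simplex $x$. Let $\Omega_m(G_1,f)$ be the real vector space of real-valued functions on the critical points of Morse index $m$. The Morse exterior derivative $d:\Omega_m\to\Omega_{m+1}$ is $$dg(x)=\sum_{y} n(x,y)\,g(y),$$ where $x$ has Morse index $m+1$, the sum is over the critical points $y$ of Morse index $m$ with $y\subset x$, and $n(x,y)=1$ if the orientation of $y$ agrees with the (boundary) orientation induced on $y$ by that of $x$, and $n(x,y)=-1$ otherwise. The $m$-th Morse cohomology group is $\ker(d|\Omega_m)/\mathrm{im}(d|\Omega_{m-1})$,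 with $\Omega_{-1}=0$. $H^m(G)$ is the simplicial cohomology with real coefficients of the Whitney complex of $G$ (whose simplices are the vertex sets of the nonempty complete subgraphs of $G$). *)

theory Defs
  imports
    Complex_Main
    "HOL-Library.Function_Algebras"
    "HOL-Library.Set_Algebras"
    "HOL-Combinatorics.Permutations"
begin

section \<open>Graphs\<close>

record 'v graph =
  verts :: "'v set"
  adj :: "'v \<Rightarrow> 'v \<Rightarrow> bool"

definition finite_simple_graph :: "'v graph \<Rightarrow> bool" where
  "finite_simple_graph G \<longleftrightarrow>
     finite (verts G) \<and>
     (\<forall>x y. adj G x y \<longrightarrow> x \<in> verts G \<and> y \<in> verts G \<and> x \<noteq> y \<and> adj G y x)"

definition induced_subgraph :: "'v graph \<Rightarrow> 'v set \<Rightarrow> 'v graph" where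
  "induced_subgraph G U =
     \<lparr>verts = verts G \<inter> U, adj = (\<lambda>x y. x \<in> U \<and> y \<in> U \<and> adj G x y)\<rparr>"

definition unit_sphere :: "'v graph \<Rightarrow> 'v \<Rightarrow> 'v graph" where
  "unit_sphere G x = induced_subgraph G {y. adj G x y}"

definition delete_vertex :: "'v graph \<Rightarrow> 'v \<Rightarrow> 'v graph" where
  "delete_vertex G x = induced_subgraph G (- {x})"

text \<open>
  Simplices are identified with their vertex sets; they are nonempty, so the truncated
  subtraction in \<open>simplex_dim\<close> is harmless.
\<close>

definition simplices :: "'v graph \<Rightarrow> 'v set set" where
  "simplices G =
     {s. s \<subseteq> verts G \<and> finite s \<and> s \<noteq> {} \<and> (\<forall>x\<in>s. \<forall>y\<in>s. x \<noteq> y \<longrightarrow> adj G x y)}"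

definition simplex_dim :: "'v set \<Rightarrow> nat" where
  "simplex_dim s = card s - 1"

definition barycentric_refinement :: "'v graph \<Rightarrow> 'v set graph" where
  "barycentric_refinement G =
     \<lparr>verts = simplices G,
      adj = (\<lambda>x y. x \<in> simplices G \<and> y \<in> simplices G \<and> x \<noteq> y \<and> (x \<subseteq> y \<or> y \<subseteq> x))\<rparr>"


section \<open>Spheres and critical points\<close>

text \<open>
  Contractibility and spheres are taken in the usual inductive sense of discrete (Evako) homotopy:
  the one-point graph is contractible, and so is a graph having a vertex whose unit sphere
  and whose deletion are both contractible. The empty graph is the \<open>-1\<close>-sphere; a
  \<open>(d+1)\<close>-sphere is a graph all of whose unit spheres are \<open>d\<close>-spheres and which becomes
  contractible after removal of some vertex.
\<close>

inductive contractible :: "'v graph \<Rightarrow> bool" where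
  point: "verts G = {x} \<Longrightarrow> contractible G"
| extend: "\<lbrakk>x \<in> verts G; contractible (unit_sphere G x); contractible (delete_vertex G x)\<rbrakk>
    \<Longrightarrow> contractible G"

inductive sphere :: "int \<Rightarrow> 'v graph \<Rightarrow> bool" where
  empty: "verts G = {} \<Longrightarrow> sphere (-1) G"
| step: "\<lbrakk>\<And>y. y \<in> verts G \<Longrightarrow> sphere d (unit_sphere G y);
          x \<in> verts G; contractible (delete_vertex G x)\<rbrakk>
    \<Longrightarrow> sphere (d + 1) G"

definition lower_sphere :: "'v graph \<Rightarrow> ('v \<Rightarrow> real) \<Rightarrow> 'v \<Rightarrow> 'v graph" where
  "lower_sphere H f x = induced_subgraph H {y. adj H x y \<and> f y < f x}"

text \<open>
  The critical points of Morse index \<open>m\<close>: those \<open>x\<close> for which the lower sphere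
  is an \<open>(m-1)\<close>-sphere.
\<close>

definition critical_points :: "'v graph \<Rightarrow> ('v \<Rightarrow> real) \<Rightarrow> nat \<Rightarrow> 'v set" where
  "critical_points H f m = {x \<in> verts H. sphere (int m - 1) (lower_sphere H f x)}"


section \<open>Orientations\<close>

text \<open>
  An orientation of a simplex is a class of orderings of its vertices up to even permutations.
  In particular a single vertex has exactly one orientation.
\<close>

definition even_class :: "'v list \<Rightarrow> 'v list set" where
  "even_class l = {permute_list p l | p. p permutes {..<length l} \<and> evenperm p}"

definition is_orientation :: "'v set \<Rightarrow> 'v list set \<Rightarrow> bool" where
  "is_orientation s ori \<longleftrightarrow> (\<exists>l. distinct l \<and> set l = s \<and> ori = even_class l)"

text \<open>
  If \<open>ori\<close> is an orientation of \<open>x\<close> and \<open>y\<close> is a codimension one face of \<open>x\<close> with opposite vertex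
  \<open>v\<close>, the boundary orientation consists of the orderings of \<open>y\<close> which, when preceded by \<open>v\<close>,
  belong to \<open>ori\<close>; so deleting the \<open>i\<close>-th vertex of \<open>[v\<^sub>0, \<dots>, v\<^sub>k]\<close> gives the sign
  \<open>(-1)^i\<close>. If \<open>y\<close> is a single vertex, the tail of the oriented edge \<open>x\<close>, the set is empty: this
  stands for the negatively oriented point, which never agrees with the orientation of \<open>y\<close>.
\<close>

definition induced_orientation :: "'v list set \<Rightarrow> 'v set \<Rightarrow> 'v list set" where
  "induced_orientation ori y = {ws. set ws = y \<and> (\<exists>v. v # ws \<in> ori)}"

definition incidence :: "('v set \<Rightarrow> 'v list set) \<Rightarrow> 'v set \<Rightarrow> 'v set \<Rightarrow> real" where
  "incidence \<omega> x y = (if \<omega> y = induced_orientation (\<omega> x) y then 1 else -1)"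


section \<open>Cohomology of cochain complexes of functions\<close>

record 'a real_space =
  points :: "'a set"
  vadd :: "'a \<Rightarrow> 'a \<Rightarrow> 'a"
  vscale :: "real \<Rightarrow> 'a \<Rightarrow> 'a"

definition isomorphic_real_spaces :: "'a real_space \<Rightarrow> 'b real_space \<Rightarrow> bool" where
  "isomorphic_real_spaces V W \<longleftrightarrow>
     (\<exists>\<phi>. bij_betw \<phi> (points V) (points W) \<and>
          (\<forall>u\<in>points V. \<forall>v\<in>points V. \<phi> (vadd V u v) = vadd W (\<phi> u) (\<phi> v)) \<and>
          (\<forall>r. \<forall>u\<in>points V. \<phi> (vscale V r u) = vscale W r (\<phi> u)))"

text \<open>
  The quotient \<open>Z / B\<close> of spaces of real functions, consisting of the cosets \<open>z + B\<close>. The sum of two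
  cosets is their elementwise sum. Adding \<open>B\<close> in the scalar multiplication only matters
  for the scalar \<open>0\<close>.
\<close>

definition quotient_space ::
  "('b \<Rightarrow> real) set \<Rightarrow> ('b \<Rightarrow> real) set \<Rightarrow> ('b \<Rightarrow> real) set real_space" where
  "quotient_space Z B =
     \<lparr>points = (\<lambda>z. z +o B) ` Z,
      vadd = (\<lambda>S T. S + T),
      vscale = (\<lambda>r S. (\<lambda>z. (\<lambda>t. r * z t)) ` S + B)\<rparr>"

definition cohomology ::
  "(nat \<Rightarrow> ('b \<Rightarrow> real) set) \<Rightarrow> (nat \<Rightarrow> ('b \<Rightarrow> real) \<Rightarrow> 'b \<Rightarrow> real) \<Rightarrow> nat
     \<Rightarrow> ('b \<Rightarrow> real) set real_space" where
  "cohomology C d m =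
     quotient_space {g \<in> C m. d m g = 0} (case m of 0 \<Rightarrow> {0} | Suc k \<Rightarrow> d k ` C k)"


section \<open>Morse cohomology\<close>

text \<open>Functions on a set are represented by functions vanishing outside that set.\<close>

definition morse_cochains :: "'v graph \<Rightarrow> ('v \<Rightarrow> real) \<Rightarrow> nat \<Rightarrow> ('v \<Rightarrow> real) set" where
  "morse_cochains H f m = {g. \<forall>x. x \<notin> critical_points H f m \<longrightarrow> g x = 0}"

definition morse_derivative ::
  "'v set graph \<Rightarrow> ('v set \<Rightarrow> real) \<Rightarrow> ('v set \<Rightarrow> 'v list set) \<Rightarrow> nat
     \<Rightarrow> ('v set \<Rightarrow> real) \<Rightarrow> 'v set \<Rightarrow> real" where
  "morse_derivative H f \<omega> m g = (\<lambda>x.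
     if x \<in> critical_points H f (Suc m)
     then \<Sum>y\<in>{y \<in> critical_points H f m. y \<subset> x}. incidence \<omega> x y * g y
     else 0)"

definition morse_cohomology ::
  "'v set graph \<Rightarrow> ('v set \<Rightarrow> real) \<Rightarrow> ('v set \<Rightarrow> 'v list set) \<Rightarrow> nat
     \<Rightarrow> ('v set \<Rightarrow> real) set real_space" where
  "morse_cohomology H f \<omega> = cohomology (morse_cochains H f) (morse_derivative H f \<omega>)"


section \<open>Simplicial cohomology of the Whitney complex\<close>

text \<open>
  Real simplicial \<open>m\<close>-cochains are linear functionals on the space of oriented simplicial chains,
  that is, alternating functions on the orderings of the \<open>m\<close>-simplices.
\<close>

definition ordered_simplices :: "'v graph \<Rightarrow> nat \<Rightarrow> 'v list set" where
  "ordered_simplices G m = {l. distinct l \<and> length l = Suc m \<and> set l \<in> simplices G}"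

definition simplicial_cochains :: "'v graph \<Rightarrow> nat \<Rightarrow> ('v list \<Rightarrow> real) set" where
  "simplicial_cochains G m =
     {c. (\<forall>l. l \<notin> ordered_simplices G m \<longrightarrow> c l = 0) \<and>
         (\<forall>l\<in>ordered_simplices G m. \<forall>p. p permutes {..<length l} \<longrightarrow>
            c (permute_list p l) = of_int (sign p) * c l)}"

definition coboundary :: "'v graph \<Rightarrow> nat \<Rightarrow> ('v list \<Rightarrow> real) \<Rightarrow> 'v list \<Rightarrow> real" where
  "coboundary G m c = (\<lambda>l.
     if l \<in> ordered_simplices G (Suc m)
     then \<Sum>i<length l. (-1) ^ i * c (take i l @ drop (Suc i) l)
     else 0)"

definition simplicial_cohomology :: "'v graph \<Rightarrow> nat \<Rightarrow> ('v list \<Rightarrow> real) set real_space" where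
  "simplicial_cohomology G = cohomology (simplicial_cochains G) (coboundary G)"

end

theory Submission
  imports Defs
begin

text \<open>
  Both cochain complexes live on the simplices of \<open>G\<close>; they differ in how a simplex enters and in how
  a cochain is encoded.

  The lower sphere of a simplex \<open>x\<close> in the Barycentric refinement is the comparability graph of the
  proper nonempty subsets of \<open>x\<close>, the Barycentric refinement of the boundary of a simplex. To see that
  it is a sphere one needs its unit spheres, their unit spheres, and so on. All of these have the same
  shape: they consist of the subsets of \<open>x\<close> that are comparable with every member of a
  chain \<open>C\<close> of subsets and not in \<open>C\<close>, and passing to the unit sphere of \<open>y\<close> adds \<open>y\<close> to the chain.
  So one induction proves that each such link is a sphere of dimension \<open>card x - card C\<close>
  (\<open>sphere_chain_link\<close>). The contractibility required of a sphere with a point removed comes from a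
  closure operator: between two consecutive members \<open>p \<subset> q\<close> of the chain choose \<open>a \<in> q - p\<close> and remove
  \<open>q - {a}\<close>; then \<open>z \<mapsto> insert a z\<close> stays below \<open>q\<close>, and its fixed points form a cone over
  \<open>insert a p\<close>. Since the dimension of a sphere is unique, the critical points of index \<open>m\<close>
  are exactly the \<open>m\<close>-simplices (\<open>critical_points_dim\<close>).

  Given the chosen orientations, a function \<open>g\<close> on the \<open>m\<close>-simplices extends uniquely to an
  alternating function on their orderings, which takes the value \<open>g s\<close> on the positive orderings of \<open>s\<close>
  and \<open>- g s\<close> on the others. This bijection (\<open>alternating_extension_bij\<close>) turns the Morse derivative
  into the coboundary (\<open>alternating_extension_derivative\<close>): moving the \<open>i\<close>-th vertex to the
  front of an ordering costs \<open>(-1) ^ i\<close>, and for an ordering \<open>v # ws\<close> the incidence number is the product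
  of the signs of \<open>v # ws\<close> and \<open>ws\<close>. An isomorphism of cochain complexes induces one in
  cohomology by taking images of cosets.
\<close>

section \<open>Contractible comparability graphs\<close>

text \<open>
  Barycentric refinements, lower spheres and all iterated unit spheres in them are of this form,
  which reduces statements about graphs to statements about set families.
\<close>

definition comparability_graph :: "'a set set \<Rightarrow> 'a set graph" where
  "comparability_graph S =
     \<lparr>verts = S, adj = (\<lambda>x y. x \<in> S \<and> y \<in> S \<and> x \<noteq> y \<and> (x \<subseteq> y \<or> y \<subseteq> x))\<rparr>"

lemma verts_comparability_graph [simp]: "verts (comparability_graph S) = S"
  by (simp add: comparability_graph_def)

lemma induced_subgraph_comparability_graph:
  "induced_subgraph (comparability_graph S) U = comparability_graph (S \<inter> U)"
  by (auto simp: induced_subgraph_def comparability_graph_def fun_eq_iff)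

lemma delete_vertex_comparability_graph:
  "delete_vertex (comparability_graph S) z = comparability_graph (S - {z})"
  by (simp add: delete_vertex_def induced_subgraph_comparability_graph Diff_eq)

lemma unit_sphere_comparability_graph:
  assumes "z \<in> S"
  shows "unit_sphere (comparability_graph S) z =
    comparability_graph {w \<in> S. w \<noteq> z \<and> (w \<subseteq> z \<or> z \<subseteq> w)}"
proof -
  have "S \<inter> {w. adj (comparability_graph S) z w} = {w \<in> S. w \<noteq> z \<and> (w \<subseteq> z \<or> z \<subseteq> w)}"
    using assms by (auto simp: comparability_graph_def)
  then show ?thesis
    by (simp add: unit_sphere_def induced_subgraph_comparability_graph)
qed

lemma contractible_remove_point:
  assumes "z \<in> S"
    and "contractible (comparability_graph {w \<in> S. w \<noteq> z \<and> (w \<subseteq> z \<or> z \<subseteq> w)})"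
    and "contractible (comparability_graph (S - {z}))"
  shows "contractible (comparability_graph S)"
proof (rule contractible.extend)
  show "z \<in> verts (comparability_graph S)" using assms(1) by simp
  show "contractible (unit_sphere (comparability_graph S) z)"
    using assms(2) by (simp add: unit_sphere_comparability_graph[OF assms(1)])
  show "contractible (delete_vertex (comparability_graph S) z)"
    using assms(3) by (simp add: delete_vertex_comparability_graph)
qed

text \<open>
  Any point other than the apex can be removed: its unit sphere and the remaining family still contain
  the apex, so both are smaller cones.
\<close>

lemma contractible_cone:
  assumes "finite S" "a \<in> S" "\<And>s. s \<in> S \<Longrightarrow> s \<subseteq> a \<or> a \<subseteq> s"
  shows "contractible (comparability_graph S)"
  using assms
proof (induction "card S" arbitrary: S rule: less_induct)
  case less
  show ?case
  proof (cases "S = {a}")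
    case True
    then show ?thesis by (intro contractible.point[of _ a]) simp
  next
    case False
    then obtain z where z: "z \<in> S" "z \<noteq> a" using less.prems(2) by blast
    let ?L = "{w \<in> S. w \<noteq> z \<and> (w \<subseteq> z \<or> z \<subseteq> w)}"
    have "?L \<subset> S" "S - {z} \<subset> S" using z by auto
    then have "card ?L < card S" "card (S - {z}) < card S"
      using less.prems(1) by (simp_all only: psubset_card_mono)
    moreover have "a \<in> ?L" "a \<in> S - {z}"
      using z less.prems(2) less.prems(3)[OF z(1)] by auto
    ultimately have "contractible (comparability_graph ?L)"
      "contractible (comparability_graph (S - {z}))"
      using less.prems by (auto intro!: less.hyps)
    then show ?thesis
      by (rule contractible_remove_point[OF z(1)])
  qed
qed

text \<open>
  Remove the non-closed sets one at a time, each time a maximal one \<open>z\<close>. What lies above \<open>z\<close> is then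
  closed and hence contains \<open>h z\<close>, so the unit sphere of \<open>z\<close> is a cone with apex \<open>h z\<close>. The process
  ends with the family of closed sets.
\<close>

lemma contractible_closure_operator:
  assumes "finite S"
    and closed: "\<And>z. z \<in> S \<Longrightarrow> h z \<in> S"
    and ext: "\<And>z. z \<in> S \<Longrightarrow> z \<subseteq> h z"
    and mono: "\<And>z w. z \<in> S \<Longrightarrow> w \<in> S \<Longrightarrow> z \<subseteq> w \<Longrightarrow> h z \<subseteq> h w"
    and idem: "\<And>z. z \<in> S \<Longrightarrow> h (h z) = h z"
    and fixed: "contractible (comparability_graph {z \<in> S. h z = z})"
  shows "contractible (comparability_graph S)"
  using assms
proof (induction "card S" arbitrary: S rule: less_induct)
  case less
  show ?case
  proof (cases "\<exists>z\<in>S. h z \<noteq> z")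
    case False
    then have "{z \<in> S. h z = z} = S" by blast
    then show ?thesis using less.prems(6) by simp
  next
    case True
    then have "finite {z \<in> S. h z \<noteq> z}" "{z \<in> S. h z \<noteq> z} \<noteq> {}"
      using less.prems(1) by auto
    then obtain z where "z \<in> {z \<in> S. h z \<noteq> z}"
      and "\<forall>w\<in>{z \<in> S. h z \<noteq> z}. z \<subseteq> w \<longrightarrow> z = w"
      by (rule finite_has_maximal[THEN bexE])
    then have z: "z \<in> S" "h z \<noteq> z"
      and maximal: "\<forall>w\<in>S. h w \<noteq> w \<longrightarrow> z \<subseteq> w \<longrightarrow> z = w"
      by simp_all
    have above: "h w = w" if "w \<in> S" "z \<subset> w" for w
      using maximal that by blast
    let ?L = "{w \<in> S. w \<noteq> z \<and> (w \<subseteq> z \<or> z \<subseteq> w)}"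
    have "contractible (comparability_graph ?L)"
    proof (rule contractible_cone[of _ "h z"])
      show "finite ?L" using less.prems(1) by simp
      show "h z \<in> ?L" using z less.prems(2,3) by simp
      show "w \<subseteq> h z \<or> h z \<subseteq> w" if "w \<in> ?L" for w
      proof (cases "w \<subseteq> z")
        case True
        then show ?thesis using less.prems(3)[OF z(1)] by blast
      next
        case False
        \<comment> \<open>By maximality of \<open>z\<close> such a \<open>w\<close> is closed, so it contains the closure of \<open>z\<close>.\<close>
        then have "h w = w" using that by (intro above) auto
        then show ?thesis using less.prems(4)[OF z(1), of w] that False by auto
      qed
    qed
    moreover have "contractible (comparability_graph (S - {z}))"
    proof (rule less.hyps)
      show "card (S - {z}) < card S"
        using z less.prems(1) by (intro psubset_card_mono) auto
      have "{w \<in> S - {z}. h w = w} = {w \<in> S. h w = w}" using z by auto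
      then show "contractible (comparability_graph {w \<in> S - {z}. h w = w})"
        using less.prems(6) by simp
      \<comment> \<open>\<open>z\<close> is not closed, hence not a value of the idempotent \<open>h\<close>.\<close>
      show "h w \<in> S - {z}" if "w \<in> S - {z}" for w
        using that less.prems(2,5) z by fastforce
    qed (use less.prems in auto)
    ultimately show ?thesis
      by (rule contractible_remove_point[OF z(1)])
  qed
qed


section \<open>Links of chains of subsets are spheres\<close>

text \<open>
  The chains of interest contain \<open>{}\<close> and \<open>x\<close>, so that these two sets, which are comparable with
  everything, are kept out of the link.
\<close>

definition chain_link :: "'a set \<Rightarrow> 'a set set \<Rightarrow> 'a set set" where
  "chain_link x C = {z. z \<subseteq> x \<and> z \<notin> C \<and> (\<forall>c\<in>C. z \<subseteq> c \<or> c \<subseteq> z)}"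

text \<open>
  The unit sphere of a single vertex determines the dimension, and only the empty graph, which
  has no vertex, is a \<open>-1\<close>-sphere.
\<close>

lemma sphere_dimension_unique:
  "sphere d H \<Longrightarrow> sphere e H \<Longrightarrow> d = e"
proof (induction d H arbitrary: e rule: sphere.induct)
  case (empty H)
  from empty.prems show ?case
    by cases (use empty.hyps in auto)
next
  case (step H d x)
  from step.prems show ?case
  proof cases
    case empty
    then show ?thesis using step.hyps by auto
  next
    case (step d' y)
    then show ?thesis
      using step.IH[of x] step.hyps by auto
  qed
qed

text \<open>
  The members of a chain have distinct cardinalities, so a chain that is not full misses some
  cardinality \<open>k\<close>. The gap is formed by the largest member below \<open>k\<close> and the smallest one above.
\<close>

lemma chain_gap:
  assumes x: "finite x" and C: "C \<subseteq> Pow x" "{} \<in> C" "x \<in> C"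
    and chain: "\<And>c d. c \<in> C \<Longrightarrow> d \<in> C \<Longrightarrow> c \<subseteq> d \<or> d \<subseteq> c"
    and card: "card C \<noteq> Suc (card x)"
  obtains p q where "p \<in> C" "q \<in> C" "p \<subset> q" "card q \<ge> card p + 2"
    "\<And>c. c \<in> C \<Longrightarrow> c \<subseteq> p \<or> q \<subseteq> c"
proof -
  have fin: "finite c" if "c \<in> C" for c using that x C(1) by (meson PowD finite_subset subsetD)
  have finC: "finite C" using x C(1) by (meson finite_Pow_iff finite_subset)
  have inj: "inj_on card C"
    using chain fin by (intro inj_onI) (metis card_subset_eq)
  have "card ` C \<subseteq> {..card x}" using C(1) x by (auto intro: card_mono)
  moreover have "card ` C \<noteq> {..card x}" using card card_image[OF inj] by auto
  ultimately obtain k where k: "k \<le> card x" "k \<notin> card ` C" by blast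
  let ?A = "{c \<in> C. card c < k}" and ?B = "{c \<in> C. k < card c}"
  have "k \<noteq> 0" using k(2) C(2) by (metis card.empty imageI)
  then have A: "finite ?A" "?A \<noteq> {}" using finC C(2) by auto
  have "k \<noteq> card x" using k(2) C(3) by blast
  then have B: "finite ?B" "?B \<noteq> {}" using finC C(3) k(1) by auto
  obtain p where p: "p \<in> ?A" "\<forall>c\<in>?A. p \<subseteq> c \<longrightarrow> p = c"
    using finite_has_maximal[OF A] by blast
  obtain q where q: "q \<in> ?B" "\<forall>c\<in>?B. c \<subseteq> q \<longrightarrow> q = c"
    using finite_has_minimal[OF B] by blast
  have "\<not> q \<subseteq> p" using p(1) q(1) fin card_mono[of p q] by fastforce
  then have "p \<subset> q" using chain[of p q] p(1) q(1) by auto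
  moreover have "c \<subseteq> p \<or> q \<subseteq> c" if "c \<in> C" for c
  proof -
    have "card c \<noteq> k" using that k(2) by blast
    then have "c \<in> ?A \<or> c \<in> ?B" using that by auto
    then show ?thesis
    proof
      assume "c \<in> ?A"
      then show ?thesis using p chain[of c p] by auto
    next
      assume "c \<in> ?B"
      then show ?thesis using q chain[of c q] by auto
    qed
  qed
  ultimately show thesis using p(1) q(1) by (intro that[of p q]) auto
qed

text \<open>
  Adding \<open>a\<close> to the sets strictly between \<open>p\<close> and \<open>q\<close> is a closure operator on the link once \<open>q - {a}\<close>,
  the only set that it would send to \<open>q\<close>, is removed. A closed set between \<open>p\<close> and \<open>q\<close> contains
  \<open>insert a p\<close>, and all other members of the link lie below \<open>p\<close> or above \<open>q\<close>, so the closed sets form a cone.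
\<close>

lemma contractible_punctured_chain_link:
  assumes x: "finite x" and C: "C \<subseteq> Pow x" "p \<in> C" "q \<in> C"
    and pq: "p \<subset> q" "card q \<ge> card p + 2"
    and gap: "\<And>c. c \<in> C \<Longrightarrow> c \<subseteq> p \<or> q \<subseteq> c"
    and a: "a \<in> q" "a \<notin> p"
  shows "q - {a} \<in> chain_link x C"
    and "contractible (comparability_graph (chain_link x C - {q - {a}}))"
proof -
  have finq: "finite q" using x C by (meson PowD finite_subset subsetD)
  have finp: "finite p" using finq pq(1) by (meson finite_subset psubset_imp_subset)
  \<comment> \<open>The gap has size at least two, so both \<open>q - {a}\<close> and \<open>insert a p\<close> lie strictly inside it.\<close>
  have coatom: "p \<subset> q - {a}"
  proof -
    have "card (q - {a}) \<noteq> card p" using a finq pq(2) by (simp add: card_Diff_singleton)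
    then show ?thesis using pq(1) a by blast
  qed
  have atom: "insert a p \<subset> q"
  proof -
    have "card (insert a p) \<noteq> card q" using a finp pq(2) by simp
    then show ?thesis using pq(1) a by blast
  qed
  have qx: "q \<subseteq> x" using C by auto
  have between: "z \<in> chain_link x C" if "p \<subset> z" "z \<subset> q" for z
    unfolding chain_link_def using that gap qx by blast
  show "q - {a} \<in> chain_link x C" using coatom a by (intro between) auto
  let ?S = "chain_link x C - {q - {a}}"
  let ?h = "\<lambda>z. if p \<subseteq> z \<and> z \<subset> q then insert a z else z"
  have comparable: "z \<subset> p \<or> q \<subset> z \<or> p \<subset> z \<and> z \<subset> q" if "z \<in> chain_link x C" for z
    using that C(2,3) unfolding chain_link_def by blast
  have below: "insert a z \<subset> q" if "z \<in> ?S" "z \<subset> q" for z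
  proof -
    have "insert a z \<noteq> q"
    proof (cases "a \<in> z")
      case True
      then show ?thesis using that(2) by (simp add: insert_absorb)
    next
      case False
      then have "z = insert a z - {a}" by simp
      then show ?thesis using that(1) by auto
    qed
    then show ?thesis using that(2) a(1) by blast
  qed
  show "contractible (comparability_graph ?S)"
  proof (rule contractible_closure_operator[where h = ?h])
    have "chain_link x C \<subseteq> Pow x" by (auto simp: chain_link_def)
    then show fin: "finite ?S" using x by (meson finite_Diff finite_Pow_iff finite_subset)
    show "?h z \<in> ?S" if "z \<in> ?S" for z
    proof (cases "p \<subseteq> z \<and> z \<subset> q")
      case True
      then have "p \<subset> z" using that comparable[of z] by auto
      then have "insert a z \<in> chain_link x C"
        using True below[OF that] by (intro between) blast+
      moreover have "insert a z \<noteq> q - {a}" by blast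
      ultimately show ?thesis using True by simp
    qed (use that in auto)
    show "z \<subseteq> ?h z" for z by auto
    show "?h z \<subseteq> ?h w" if "z \<in> ?S" "w \<in> ?S" "z \<subseteq> w" for z w
    proof (cases "p \<subseteq> z \<and> z \<subset> q")
      case True
      then have "\<not> w \<subset> p" using that(3) by blast
      moreover have "w \<in> chain_link x C" using that(2) by simp
      ultimately consider "q \<subset> w" | "p \<subset> w" "w \<subset> q" using comparable[of w] by blast
      then show ?thesis
      proof cases
        case 1
        then have "?h w = w" "insert a z \<subseteq> w" using a(1) that(3) by auto
        then show ?thesis using True by simp
      next
        case 2
        then have "?h w = insert a w" by auto
        then show ?thesis using True insert_mono[OF that(3), of a] by simp
      qed
    next
      case False
      have "w \<subseteq> ?h w" by auto
      then show ?thesis unfolding if_not_P[OF False] using that(3) by (rule subset_trans[rotated])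
    qed
    show "?h (?h z) = ?h z" for z by (simp add: insert_absorb)
    show "contractible (comparability_graph {z \<in> ?S. ?h z = z})"
    proof (rule contractible_cone[of _ "insert a p"])
      have "insert a p \<in> chain_link x C" using atom a by (intro between) auto
      moreover have "insert a p \<noteq> q - {a}" by blast
      ultimately show "insert a p \<in> {z \<in> ?S. ?h z = z}" by simp
      show "z \<subseteq> insert a p \<or> insert a p \<subseteq> z" if "z \<in> {z \<in> ?S. ?h z = z}" for z
      proof (cases "p \<subset> z \<and> z \<subset> q")
        case True
        then have "insert a z = z" using that by (simp add: psubset_imp_subset)
        then show ?thesis using True by blast
      next
        case False
        then have "z \<subset> p \<or> q \<subset> z" using that comparable[of z] by blast
        then show ?thesis using a(1) pq(1) by blast
      qed
    qed (use fin in simp)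
  qed
qed

text \<open>
  The unit sphere of \<open>y\<close> in the link of \<open>C\<close> is the link of the longer chain \<open>insert y C\<close>, which is a
  sphere of one dimension less by induction. A full chain has \<open>card x + 1\<close> members and an
  empty link.
\<close>

lemma sphere_chain_link:
  assumes "finite x" "C \<subseteq> Pow x" "{} \<in> C" "x \<in> C"
    and "\<And>c d. c \<in> C \<Longrightarrow> d \<in> C \<Longrightarrow> c \<subseteq> d \<or> d \<subseteq> c"
  shows "sphere (int (card x) - int (card C)) (comparability_graph (chain_link x C))"
  using assms
proof (induction "card (chain_link x C)" arbitrary: C rule: less_induct)
  case less
  note x = less.prems(1) and chain = less.prems(5)
  have finC: "finite C" using x less.prems(2) by (meson finite_Pow_iff finite_subset)
  have fin: "finite (chain_link x C)"
    using x by (rule finite_subset[rotated, OF finite_Pow_iff[THEN iffD2]]) (auto simp: chain_link_def)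
  show ?case
  proof (cases "card C = Suc (card x)")
    case True
    have finc: "finite z" if "z \<subseteq> x" for z using that x by (rule finite_subset)
    have inj: "inj_on card C"
      using chain less.prems(2) finc by (intro inj_onI) (metis PowD card_subset_eq subsetD)
    have "card ` C \<subseteq> {..card x}" using less.prems(2) x by (auto intro: card_mono)
    then have "card ` C = {..card x}"
      using True card_image[OF inj] by (intro card_subset_eq) auto
    \<comment> \<open>A full chain meets every cardinality, and comparable sets of the same cardinality agree.\<close>
    then have "chain_link x C = {}"
    proof -
      have False if z: "z \<in> chain_link x C" for z
      proof -
        have "z \<subseteq> x" using z by (simp add: chain_link_def)
        then have "card z \<in> card ` C" using \<open>card ` C = {..card x}\<close> x by (simp add: card_mono)
        then obtain c where "c \<in> C" "card c = card z" by (metis imageE)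
        then have "c = z"
        proof -
          have "c \<subseteq> x" using \<open>c \<in> C\<close> less.prems(2) by blast
          moreover have "z \<subseteq> c \<or> c \<subseteq> z" using z \<open>c \<in> C\<close> by (simp add: chain_link_def)
          ultimately show ?thesis
            using \<open>card c = card z\<close> finc[of c] finc[OF \<open>z \<subseteq> x\<close>] card_subset_eq[of c z]
              card_subset_eq[of z c] by auto
        qed
        then show False using \<open>c \<in> C\<close> z by (simp add: chain_link_def)
      qed
      then show ?thesis by blast
    qed
    then show ?thesis using True by (simp add: sphere.empty)
  next
    case False
    obtain p q where pq: "p \<in> C" "q \<in> C" "p \<subset> q" "card q \<ge> card p + 2"
      "\<And>c. c \<in> C \<Longrightarrow> c \<subseteq> p \<or> q \<subseteq> c"
      using chain_gap[OF less.prems False] by metis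
    obtain a where a: "a \<in> q" "a \<notin> p" using pq(3) by blast
    note puncture = contractible_punctured_chain_link[OF x less.prems(2) pq a]
    have "sphere (int (card x) - int (card C) - 1) (unit_sphere (comparability_graph (chain_link x C)) y)"
      if y: "y \<in> verts (comparability_graph (chain_link x C))" for y
    proof -
      have y': "y \<in> chain_link x C" using y by simp
      have link: "chain_link x (insert y C) =
          {w \<in> chain_link x C. w \<noteq> y \<and> (w \<subseteq> y \<or> y \<subseteq> w)}"
        by (auto simp: chain_link_def)
      have "sphere (int (card x) - int (card (insert y C)))
          (comparability_graph (chain_link x (insert y C)))"
      proof (rule less.hyps)
        show "card (chain_link x (insert y C)) < card (chain_link x C)"
          unfolding link using y' fin by (intro psubset_card_mono) auto
        show "c \<subseteq> d \<or> d \<subseteq> c" if "c \<in> insert y C" "d \<in> insert y C" for c d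
          using that chain y' by (auto simp: chain_link_def)
      qed (use less.prems y' in \<open>auto simp: chain_link_def\<close>)
      moreover have "card (insert y C) = Suc (card C)"
        using y' finC by (simp add: chain_link_def)
      ultimately show ?thesis
        using y' by (simp add: link unit_sphere_comparability_graph algebra_simps)
    qed
    from sphere.step[OF this, of "q - {a}"] show ?thesis
      using puncture by (simp add: delete_vertex_comparability_graph)
  qed
qed


section \<open>Critical points of the dimension function\<close>

text \<open>
  The sets comparable with \<open>x\<close> that have smaller dimension are the proper faces of \<open>x\<close>, and
  every nonempty subset of a simplex of \<open>G\<close> is again a simplex.
\<close>

lemma lower_sphere_dim:
  assumes x: "x \<in> simplices G"
  shows "lower_sphere (barycentric_refinement G) (\<lambda>x. real (simplex_dim x)) x =
    comparability_graph (chain_link x {{}, x})"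
proof -
  have fin: "finite x" and ne: "x \<noteq> {}" using x by (auto simp: simplices_def)
  have faces: "y \<in> simplices G" if "y \<subseteq> x" "y \<noteq> {}" for y
    using that x by (auto simp: simplices_def intro: finite_subset)
  have less: "simplex_dim y < simplex_dim x" if "y \<subset> x" "y \<noteq> {}" for y
  proof -
    have "card y < card x" using fin that(1) by (rule psubset_card_mono)
    moreover have "card y \<noteq> 0" using that fin by (meson card_eq_0_iff finite_subset psubset_imp_subset)
    ultimately show ?thesis by (simp add: simplex_dim_def)
  qed
  have ge: "simplex_dim x \<le> simplex_dim y" if "x \<subseteq> y" "y \<in> simplices G" for y
    using that by (auto simp: simplex_dim_def simplices_def intro!: diff_le_mono card_mono)
  have "simplices G \<inter> {y. adj (comparability_graph (simplices G)) x y \<and>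
      real (simplex_dim y) < real (simplex_dim x)} = chain_link x {{}, x}"
  proof (intro equalityI subsetI)
    fix y assume "y \<in> simplices G \<inter> {y. adj (comparability_graph (simplices G)) x y \<and>
      real (simplex_dim y) < real (simplex_dim x)}"
    then have y: "y \<in> simplices G" "x \<noteq> y" "x \<subseteq> y \<or> y \<subseteq> x" "simplex_dim y < simplex_dim x"
      by (auto simp: comparability_graph_def)
    then have "\<not> x \<subseteq> y" using ge[of y] by auto
    moreover have "y \<noteq> {}" using y(1) by (simp add: simplices_def)
    ultimately show "y \<in> chain_link x {{}, x}" using y by (auto simp: chain_link_def)
  next
    fix y assume "y \<in> chain_link x {{}, x}"
    then have "y \<subset> x" "y \<noteq> {}" by (auto simp: chain_link_def)
    then show "y \<in> simplices G \<inter> {y. adj (comparability_graph (simplices G)) x y \<and>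
      real (simplex_dim y) < real (simplex_dim x)}"
      using faces[of y] less[of y] x by (auto simp: comparability_graph_def)
  qed
  moreover have "barycentric_refinement G = comparability_graph (simplices G)"
    by (simp add: barycentric_refinement_def comparability_graph_def)
  ultimately show ?thesis
    by (simp add: lower_sphere_def induced_subgraph_comparability_graph)
qed

lemma critical_points_dim:
  "critical_points (barycentric_refinement G) (\<lambda>x. real (simplex_dim x)) m =
    {x \<in> simplices G. card x = Suc m}"
proof -
  have "sphere (int m - 1) (lower_sphere (barycentric_refinement G) (\<lambda>x. real (simplex_dim x)) x)
      \<longleftrightarrow> card x = Suc m" if x: "x \<in> simplices G" for x
  proof -
    have fin: "finite x" and ne: "x \<noteq> {}" using x by (auto simp: simplices_def)
    have "card {{}, x} = 2" using ne by simp
    then have "sphere (int (card x) - 2) (comparability_graph (chain_link x {{}, x}))"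
      using sphere_chain_link[of x "{{}, x}"] fin by auto
    then have "sphere (int m - 1) (comparability_graph (chain_link x {{}, x}))
        \<longleftrightarrow> int m - 1 = int (card x) - 2"
      using sphere_dimension_unique by metis
    then show ?thesis by (auto simp: lower_sphere_dim[OF x])
  qed
  then show ?thesis
    by (auto simp: critical_points_def barycentric_refinement_def)
qed


section \<open>Orientation signs\<close>

definition orientation_sign :: "'v list set \<Rightarrow> 'v list \<Rightarrow> real" where
  "orientation_sign E l = (if l \<in> E then 1 else -1)"

lemma orientation_sign_square: "orientation_sign E l * orientation_sign E l = 1"
  by (simp add: orientation_sign_def)

lemma permute_list_inject:
  assumes "distinct b" "p permutes {..<length b}" "q permutes {..<length b}"
    and eq: "permute_list p b = permute_list q b"
  shows "p = q"
proof
  fix i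
  show "p i = q i"
  proof (cases "i < length b")
    case True
    then have "b ! p i = b ! q i"
      using eq permute_list_nth[OF assms(2) True] permute_list_nth[OF assms(3) True] by simp
    moreover have "p i < length b" "q i < length b"
      using True permutes_in_image[OF assms(2)] permutes_in_image[OF assms(3)] by auto
    ultimately show ?thesis using assms(1) by (simp add: nth_eq_iff_index_eq)
  next
    case False
    then show ?thesis using assms(2,3) by (simp add: permutes_not_in)
  qed
qed

lemma orderings_related_by_permutation:
  assumes "distinct l" "distinct b" "set l = set b"
  obtains q where "q permutes {..<length b}" "permute_list q b = l"
proof -
  have "mset l = mset b" using assms by (simp add: set_eq_iff_mset_eq_distinct)
  then show thesis using that by (rule mset_eq_permutation)
qed

lemma orientation_orderings:
  assumes "is_orientation s E" "l \<in> E"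
  shows "distinct l" "set l = s"
  using assms by (auto simp: is_orientation_def even_class_def)

lemma orientation_nonempty:
  assumes "is_orientation s E"
  obtains l where "l \<in> E"
proof -
  obtain b where "E = even_class b" using assms by (auto simp: is_orientation_def)
  then have "permute_list id b \<in> E"
    unfolding even_class_def using permutes_id evenperm_id by blast
  then show thesis using that by blast
qed

text \<open>
  Any ordering is a permutation of the ordering \<open>b\<close> that represents the orientation, and that permutation is
  unique since \<open>b\<close> is distinct. So the sign of an ordering is the sign of this permutation, and
  signs of permutations are multiplicative.
\<close>

lemma orientation_sign_permute:
  assumes E: "is_orientation s E" and l: "distinct l" "set l = s"
    and p: "p permutes {..<length l}"
  shows "orientation_sign E (permute_list p l) = of_int (sign p) * orientation_sign E l"
proof -
  obtain b where b: "distinct b" "set b = s" "E = even_class b"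
    using E by (auto simp: is_orientation_def)
  have mem: "permute_list r b \<in> E \<longleftrightarrow> evenperm r" if "r permutes {..<length b}" for r
    using permute_list_inject[OF b(1) that] that by (auto simp: b(3) even_class_def)
  obtain q where q: "q permutes {..<length b}" "permute_list q b = l"
    using orderings_related_by_permutation[OF l(1) b(1)] l(2) b(2) by auto
  have p': "p permutes {..<length b}" using p q(2) by auto
  have "permute_list p l = permute_list (q \<circ> p) b"
    using permute_list_compose[OF p'] q(2) by simp
  moreover have "q \<circ> p permutes {..<length b}" using p' q(1) by (rule permutes_compose)
  moreover have "evenperm (q \<circ> p) \<longleftrightarrow> evenperm q = evenperm p"
    using p' q(1) by (intro evenperm_comp) (auto simp: permutation_permutes)
  ultimately show ?thesis
    using mem[of "q \<circ> p"] mem[OF q(1)] q(2) by (auto simp: orientation_sign_def sign_def)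
qed

lemma orientation_sign_swap:
  assumes E: "is_orientation s E" and l: "distinct (xs @ a # b # ys)" "set (xs @ a # b # ys) = s"
  shows "orientation_sign E (xs @ b # a # ys) = - orientation_sign E (xs @ a # b # ys)"
proof -
  let ?l = "xs @ a # b # ys" and ?t = "transpose (length xs) (Suc (length xs))"
  have t: "?t permutes {..<length ?l}" by (intro permutes_swap_id) auto
  have "permute_list ?t ?l = xs @ b # a # ys"
  proof (rule nth_equalityI)
    fix i assume "i < length (permute_list ?t ?l)"
    then have "permute_list ?t ?l ! i = ?l ! ?t i" using permute_list_nth[OF t] by simp
    also have "\<dots> = (xs @ b # a # ys) ! i"
      by (auto simp: transpose_def nth_append nth_Cons' split: if_splits)
    finally show "permute_list ?t ?l ! i = (xs @ b # a # ys) ! i" .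
  qed simp
  then show ?thesis using orientation_sign_permute[OF E l t] by (simp add: sign_swap_id)
qed

lemma orientation_sign_move:
  assumes "is_orientation s E" "distinct (xs @ as @ v # ys)" "set (xs @ as @ v # ys) = s"
  shows "orientation_sign E (xs @ v # as @ ys) =
    (-1) ^ length as * orientation_sign E (xs @ as @ v # ys)"
  using assms
proof (induction as arbitrary: xs)
  case Nil
  then show ?case by simp
next
  case (Cons a as)
  have "orientation_sign E (xs @ v # a # as @ ys) = - orientation_sign E (xs @ a # v # as @ ys)"
    using Cons.prems by (intro orientation_sign_swap[of s]) auto
  also have "orientation_sign E (xs @ a # v # as @ ys) =
      (-1) ^ length as * orientation_sign E (xs @ a # as @ v # ys)"
    using Cons.IH[of "xs @ [a]"] Cons.prems by simp
  finally show ?case by simp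
qed

lemma orientation_sign_Cons_permute:
  assumes E: "is_orientation s E" and l: "distinct (v # ws)" "set (v # ws) = s"
    and p: "p permutes {..<length ws}"
  shows "orientation_sign E (v # permute_list p ws) =
    of_int (sign p) * orientation_sign E (v # ws)"
proof -
  let ?n = "length ws"
  \<comment> \<open>\<open>p\<close> shifted by one position; \<open>0\<close>, the position of \<open>v\<close>, stays fixed.\<close>
  let ?P = "map_permutation {..<?n} Suc p"
  have P: "?P permutes Suc ` {..<?n}"
    by (rule map_permutation_permutes[OF _ p]) (auto simp: bij_betw_def)
  then have P': "?P permutes {..<length (v # ws)}"
    by (rule permutes_subset) auto
  have "permute_list ?P (v # ws) = v # permute_list p ws"
  proof (rule nth_equalityI)
    fix i assume i: "i < length (permute_list ?P (v # ws))"
    then have nth: "permute_list ?P (v # ws) ! i = (v # ws) ! ?P i"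
      using permute_list_nth[OF P'] by simp
    show "permute_list ?P (v # ws) ! i = (v # permute_list p ws) ! i"
    proof (cases i)
      case 0
      then show ?thesis using nth permutes_not_in[OF P, of 0] by simp
    next
      case (Suc j)
      then have j: "j < ?n" using i by simp
      then have "?P (Suc j) = Suc (p j)"
        by (intro map_permutation_apply) auto
      then show ?thesis using nth Suc permute_list_nth[OF p j] by simp
    qed
  qed simp
  moreover have "sign ?P = sign p" using p by (intro sign_map_permutation) auto
  ultimately show ?thesis using orientation_sign_permute[OF E l P'] by simp
qed

text \<open>
  Permuting \<open>us\<close> changes the sign of \<open>v # us\<close> and that of \<open>us\<close> in the same way, so the product of the two
  is the same for all orderings \<open>us\<close> of the face. If it is \<open>1\<close>, the induced orientation
  consists of the positive orderings of the face; if it is \<open>-1\<close>, it contains none of them. The second case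
  covers the tail of an edge, where the induced orientation is empty.
\<close>

lemma incidence_eq_orientation_signs:
  assumes x: "is_orientation (set (v # ws)) (\<omega> (set (v # ws)))"
    and y: "is_orientation (set ws) (\<omega> (set ws))"
    and l: "distinct (v # ws)"
  shows "incidence \<omega> (set (v # ws)) (set ws) =
    orientation_sign (\<omega> (set (v # ws))) (v # ws) * orientation_sign (\<omega> (set ws)) ws"
proof -
  let ?X = "\<omega> (set (v # ws))" and ?Y = "\<omega> (set ws)"
  let ?\<kappa> = "orientation_sign ?X (v # ws) * orientation_sign ?Y ws"
  have const: "orientation_sign ?X (v # us) * orientation_sign ?Y us = ?\<kappa>"
    if us: "distinct us" "set us = set ws" for us
  proof -
    obtain p where p: "p permutes {..<length ws}" "permute_list p ws = us"
      using orderings_related_by_permutation[OF us(1) _ us(2)] l by auto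
    have "orientation_sign ?X (v # us) = of_int (sign p) * orientation_sign ?X (v # ws)"
      using orientation_sign_Cons_permute[OF x l refl p(1)] p(2) by simp
    moreover have "orientation_sign ?Y us = of_int (sign p) * orientation_sign ?Y ws"
      using orientation_sign_permute[OF y _ refl p(1)] p(2) l by simp
    ultimately show ?thesis by (cases p rule: sign_cases) auto
  qed
  have ind: "us \<in> induced_orientation ?X (set ws) \<longleftrightarrow>
      distinct us \<and> set us = set ws \<and> v # us \<in> ?X" for us
  proof
    assume "us \<in> induced_orientation ?X (set ws)"
    then obtain u where us: "set us = set ws" and u: "u # us \<in> ?X"
      by (auto simp: induced_orientation_def)
    have "distinct (u # us)" "set (u # us) = set (v # ws)"
      using orientation_orderings[OF x u] by auto
    then have "u = v" "distinct us" using us l by auto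
    then show "distinct us \<and> set us = set ws \<and> v # us \<in> ?X" using u us by simp
  qed (auto simp: induced_orientation_def)
  have mem: "us \<in> ?Y \<longleftrightarrow> distinct us \<and> set us = set ws \<and> us \<in> ?Y" for us
    using orientation_orderings[OF y] by blast
  show ?thesis
  proof (cases "?\<kappa> = 1")
    case True
    have "us \<in> ?Y \<longleftrightarrow> v # us \<in> ?X" if "distinct us" "set us = set ws" for us
      using const[OF that] True by (auto simp: orientation_sign_def split: if_splits)
    then have "?Y = induced_orientation ?X (set ws)" using mem ind by blast
    then show ?thesis using True by (simp add: incidence_def)
  next
    case False
    then have \<kappa>: "?\<kappa> = -1" by (auto simp: orientation_sign_def split: if_splits)
    obtain us where us: "us \<in> ?Y" using orientation_nonempty[OF y] .
    have "v # us \<notin> ?X"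
      using const[of us] orientation_orderings[OF y us] us \<kappa>
      by (auto simp: orientation_sign_def split: if_splits)
    then have "?Y \<noteq> induced_orientation ?X (set ws)" using us ind by blast
    then show ?thesis using \<kappa> by (simp add: incidence_def)
  qed
qed

text \<open>
  Moving the \<open>i\<close>-th vertex to the front contributes \<open>(-1) ^ i\<close> and reduces the computation to the
  incidence number of the face opposite to a leading vertex.
\<close>

lemma orientation_sign_face:
  assumes x: "is_orientation (set l) (\<omega> (set l))"
    and l: "distinct l" and i: "i < length l"
    and y: "is_orientation (set l - {l ! i}) (\<omega> (set l - {l ! i}))"
  shows "set (take i l @ drop (Suc i) l) = set l - {l ! i}"
    and "(-1) ^ i * orientation_sign (\<omega> (set l - {l ! i})) (take i l @ drop (Suc i) l) =
      orientation_sign (\<omega> (set l)) l * incidence \<omega> (set l) (set l - {l ! i})"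
proof -
  let ?v = "l ! i" and ?as = "take i l" and ?ys = "drop (Suc i) l"
  have split: "l = ?as @ ?v # ?ys" using i by (rule id_take_nth_drop)
  have dist: "distinct (?as @ ?v # ?ys)" using l split by simp
  have set_l: "set l = set (?as @ ?v # ?ys)" by (rule arg_cong[OF split])
  show face: "set (?as @ ?ys) = set l - {?v}" using dist set_l by auto
  have first: "set (?v # ?as @ ?ys) = set l" using set_l by auto
  have "orientation_sign (\<omega> (set l)) (?v # ?as @ ?ys) =
      (-1) ^ length ?as * orientation_sign (\<omega> (set l)) (?as @ ?v # ?ys)"
    using orientation_sign_move[OF x, of "[]" ?as ?v ?ys] dist set_l by simp
  then have move: "orientation_sign (\<omega> (set l)) (?v # ?as @ ?ys) =
      (-1) ^ i * orientation_sign (\<omega> (set l)) l"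
    using i split by simp
  have "incidence \<omega> (set l) (set l - {?v}) =
      (-1) ^ i * orientation_sign (\<omega> (set l)) l *
        orientation_sign (\<omega> (set l - {?v})) (?as @ ?ys)"
    using incidence_eq_orientation_signs[of ?v "?as @ ?ys" \<omega>] x y dist
    unfolding first face move by auto
  then show "(-1) ^ i * orientation_sign (\<omega> (set l - {?v})) (?as @ ?ys) =
      orientation_sign (\<omega> (set l)) l * incidence \<omega> (set l) (set l - {?v})"
    using orientation_sign_square[of "\<omega> (set l)" l] by (simp add: algebra_simps)
qed


section \<open>Isomorphic cochain complexes have isomorphic cohomology\<close>

text \<open>
  A single map \<open>\<Psi>\<close> serves all degrees. It sends cocycles onto cocycles because it is injective in degree
  \<open>m + 1\<close>, and coboundaries onto coboundaries because it is surjective in degree \<open>m - 1\<close>. The induced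
  map on cohomology is \<open>S \<mapsto> \<Psi> ` S\<close>; it is injective since all cosets lie in \<open>C m\<close>, where \<open>\<Psi>\<close> is
  injective.
\<close>

lemma cohomology_isomorphic:
  fixes \<Psi> :: "('a \<Rightarrow> real) \<Rightarrow> 'b \<Rightarrow> real"
  assumes add: "\<And>u v. \<Psi> (u + v) = \<Psi> u + \<Psi> v"
    and scale: "\<And>r u. \<Psi> (\<lambda>t. r * u t) = (\<lambda>t. r * \<Psi> u t)"
    and bij: "\<And>k. bij_betw \<Psi> (C k) (D k)"
    and comm: "\<And>k g. g \<in> C k \<Longrightarrow> e k (\<Psi> g) = \<Psi> (d k g)"
    and d: "\<And>k g. g \<in> C k \<Longrightarrow> d k g \<in> C (Suc k)"
    and zero: "\<And>k. 0 \<in> C k"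
    and closed: "\<And>k u v. u \<in> C k \<Longrightarrow> v \<in> C k \<Longrightarrow> u + v \<in> C k"
  shows "isomorphic_real_spaces (cohomology C d m) (cohomology D e m)"
proof -
  have \<Psi>0: "\<Psi> 0 = 0" using add[of 0 0] by simp
  define Z B where "Z = {g \<in> C m. d m g = 0}" and "B = (case m of 0 \<Rightarrow> {0} | Suc k \<Rightarrow> d k ` C k)"
  have D: "D k = \<Psi> ` C k" for k using bij[of k] by (simp add: bij_betw_def)
  have inj: "inj_on \<Psi> (C k)" for k using bij[of k] by (simp add: bij_betw_def)
  have BC: "B \<subseteq> C m" using d zero by (auto simp: B_def split: nat.splits)
  have kernel: "e m (\<Psi> g) = 0 \<longleftrightarrow> d m g = 0" if "g \<in> C m" for g
    using comm[OF that] \<Psi>0 inj_onD[OF inj _ d[OF that] zero] by auto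
  have Z: "{g \<in> D m. e m g = 0} = \<Psi> ` Z"
    unfolding D Z_def using kernel by blast
  have B: "(case m of 0 \<Rightarrow> {0} | Suc k \<Rightarrow> e k ` D k) = \<Psi> ` B"
    using comm by (auto simp: B_def D \<Psi>0 image_image split: nat.splits intro!: image_cong)
  have image_plus: "\<Psi> ` (S + T) = \<Psi> ` S + \<Psi> ` T" for S T
    by (force simp: set_plus_def add)
  have image_coset: "\<Psi> ` (z +o S) = \<Psi> z +o \<Psi> ` S" for z S
    by (force simp: elt_set_plus_def add)
  have image_scale: "\<Psi> ` (\<lambda>z t. r * z t) ` S = (\<lambda>z t. r * z t) ` \<Psi> ` S" for r S
    by (simp add: image_image scale)
  have cosets: "z +o B \<subseteq> C m" if "z \<in> Z" for z
    using that BC closed by (auto simp: elt_set_plus_def Z_def)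
  have "inj_on ((`) \<Psi>) ((\<lambda>z. z +o B) ` Z)"
    using cosets by (intro inj_on_subset[OF inj_on_image_Pow[OF inj]]) auto
  moreover have "(`) \<Psi> ` (\<lambda>z. z +o B) ` Z = (\<lambda>z. z +o \<Psi> ` B) ` \<Psi> ` Z"
    by (simp add: image_image image_coset)
  ultimately have "bij_betw ((`) \<Psi>) (points (cohomology C d m)) (points (cohomology D e m))"
    unfolding cohomology_def quotient_space_def Z B
    by (simp add: bij_betw_def Z_def B_def)
  then show ?thesis
    unfolding isomorphic_real_spaces_def
  proof (intro exI[of _ "(`) \<Psi>"] conjI ballI allI)
    fix S T
    show "\<Psi> ` vadd (cohomology C d m) S T = vadd (cohomology D e m) (\<Psi> ` S) (\<Psi> ` T)"
      by (simp add: cohomology_def quotient_space_def image_plus)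
  next
    fix r S
    show "\<Psi> ` vscale (cohomology C d m) r S = vscale (cohomology D e m) r (\<Psi> ` S)"
      unfolding cohomology_def quotient_space_def B
      by (simp add: image_plus image_scale B_def)
  qed
qed


section \<open>Simplicial cochains as functions on simplices\<close>

definition alternating_extension ::
  "('v set \<Rightarrow> 'v list set) \<Rightarrow> ('v set \<Rightarrow> real) \<Rightarrow> 'v list \<Rightarrow> real" where
  "alternating_extension \<omega> g l =
     (if distinct l then orientation_sign (\<omega> (set l)) l * g (set l) else 0)"

text \<open>
  A cochain is recovered from its values on one positive ordering of each simplex, because the
  alternating property determines it on all other orderings.
\<close>

lemma alternating_extension_bij:
  assumes \<omega>: "\<And>s. s \<in> simplices G \<Longrightarrow> is_orientation s (\<omega> s)"
  shows "bij_betw (alternating_extension \<omega>)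
    {g. \<forall>s. s \<notin> {s \<in> simplices G. card s = Suc k} \<longrightarrow> g s = 0} (simplicial_cochains G k)"
    (is "bij_betw ?\<Psi> ?C ?D")
proof (rule bij_betw_imageI)
  have ordered: "l \<in> ordered_simplices G k \<longleftrightarrow>
      distinct l \<and> set l \<in> {s \<in> simplices G. card s = Suc k}" for l
    by (auto simp: ordered_simplices_def distinct_card)
  have eval_oriented: "?\<Psi> g l = g s" if "s \<in> simplices G" "l \<in> \<omega> s" for g l s
    using orientation_orderings[OF \<omega>[OF that(1)] that(2)] that(2)
    by (simp add: alternating_extension_def orientation_sign_def)
  show "inj_on ?\<Psi> ?C"
  proof (intro inj_onI ext)
    fix g h s assume gh: "g \<in> ?C" "h \<in> ?C" "?\<Psi> g = ?\<Psi> h"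
    show "g s = h s"
    proof (cases "s \<in> simplices G")
      case True
      obtain l where "l \<in> \<omega> s" using orientation_nonempty[OF \<omega>[OF True]] .
      then show ?thesis using eval_oriented[OF True] gh(3) by metis
    qed (use gh in simp)
  qed
  show "?\<Psi> ` ?C = ?D"
  proof (intro equalityI subsetI)
    fix c assume "c \<in> ?\<Psi> ` ?C"
    then obtain g where g: "g \<in> ?C" "c = ?\<Psi> g" by blast
    have "c l = 0" if "l \<notin> ordered_simplices G k" for l
      using that g by (auto simp: ordered alternating_extension_def)
    moreover have "c (permute_list p l) = of_int (sign p) * c l"
      if "l \<in> ordered_simplices G k" "p permutes {..<length l}" for l p
      using that g(2) orientation_sign_permute[OF \<omega> _ refl that(2)]
      by (simp add: ordered alternating_extension_def)
    ultimately show "c \<in> ?D" by (simp add: simplicial_cochains_def)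
  next
    fix c assume c: "c \<in> ?D"
    define g where "g s = (if s \<in> simplices G \<and> card s = Suc k then c (SOME l. l \<in> \<omega> s) else 0)" for s
    have "?\<Psi> g l = c l" for l
    proof (cases "l \<in> ordered_simplices G k")
      case True
      let ?s = "set l"
      have l: "distinct l" "?s \<in> simplices G" "card ?s = Suc k" using True by (auto simp: ordered)
      define b where "b = (SOME b. b \<in> \<omega> ?s)"
      have "\<exists>b. b \<in> \<omega> ?s" using orientation_nonempty[OF \<omega>[OF l(2)]] by blast
      then have b: "b \<in> \<omega> ?s" unfolding b_def by (rule someI_ex)
      note b' = orientation_orderings[OF \<omega>[OF l(2)] b]
      obtain p where p: "p permutes {..<length b}" "permute_list p b = l"
        using orderings_related_by_permutation[OF l(1) b'(1)] b'(2) by auto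
      have "b \<in> ordered_simplices G k" using l b' by (simp add: ordered)
      then have "c l = of_int (sign p) * c b"
        using c p by (auto simp: simplicial_cochains_def)
      moreover have "orientation_sign (\<omega> ?s) l = of_int (sign p)"
        using orientation_sign_permute[OF \<omega>[OF l(2)] b' p(1)] p(2) b
        by (simp add: orientation_sign_def[of _ b])
      moreover have "g ?s = c b" using l by (simp add: g_def b_def)
      ultimately show ?thesis using l(1) by (simp add: alternating_extension_def)
    next
      case False
      then show ?thesis
        using c by (auto simp: ordered alternating_extension_def g_def simplicial_cochains_def)
    qed
    then have "c = ?\<Psi> g" by auto
    moreover have "g \<in> ?C" by (simp add: g_def)
    ultimately show "c \<in> ?\<Psi> ` ?C" by blast
  qed
qed

lemma codimension_one_faces:
  assumes l: "distinct l" "length l = Suc (Suc k)" and s: "set l \<in> simplices G"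
  shows "bij_betw (\<lambda>i. set l - {l ! i}) {..<length l}
    {y \<in> {s \<in> simplices G. card s = Suc k}. y \<subset> set l}"
proof (rule bij_betw_imageI)
  show "inj_on (\<lambda>i. set l - {l ! i}) {..<length l}"
  proof (rule inj_onI)
    fix i j assume ij: "i \<in> {..<length l}" "j \<in> {..<length l}" "set l - {l ! i} = set l - {l ! j}"
    then have "l ! i = l ! j" using nth_mem[of i l] nth_mem[of j l] by blast
    then show "i = j" using ij l by (simp add: nth_eq_iff_index_eq)
  qed
  have card: "card (set l) = Suc (Suc k)" using l by (simp add: distinct_card)
  show "(\<lambda>i. set l - {l ! i}) ` {..<length l} = {y \<in> {s \<in> simplices G. card s = Suc k}. y \<subset> set l}"
  proof (intro equalityI subsetI)
    fix y assume "y \<in> (\<lambda>i. set l - {l ! i}) ` {..<length l}"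
    then obtain i where i: "i < length l" and y: "y = set l - {l ! i}" by auto
    have "card y = Suc k" using card i by (simp add: y card_Diff_singleton)
    moreover from this have "y \<noteq> {}" by auto
    ultimately show "y \<in> {y \<in> {s \<in> simplices G. card s = Suc k}. y \<subset> set l}"
      using s nth_mem[OF i] by (auto simp: y simplices_def)
  next
    fix y assume "y \<in> {y \<in> {s \<in> simplices G. card s = Suc k}. y \<subset> set l}"
    then have y: "card y = Suc k" "y \<subset> set l" by auto
    have "card (set l - y) = 1"
      using card_Diff_subset[of y "set l"] y card finite_subset[of y "set l"] by auto
    then obtain v where v: "set l - y = {v}" by (rule card_1_singletonE)
    then have "v \<in> set l" by blast
    then obtain i where i: "i < length l" "l ! i = v" by (auto simp: in_set_conv_nth)
    have "y = set l - {l ! i}" using v y(2) i(2) by blast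
    then show "y \<in> (\<lambda>i. set l - {l ! i}) ` {..<length l}" using i(1) by blast
  qed
qed

text \<open>
  Summing over the positions \<open>i\<close> in an ordering of \<open>x\<close> is summing over the codimension one faces of
  \<open>x\<close>, and the summands agree by \<open>orientation_sign_face\<close>, up to the common factor given
  by the sign of the ordering of \<open>x\<close>.
\<close>

lemma alternating_extension_derivative:
  assumes \<omega>: "\<And>s. s \<in> simplices G \<Longrightarrow> is_orientation s (\<omega> s)"
  shows "coboundary G k (alternating_extension \<omega> g) =
    alternating_extension \<omega> (morse_derivative (barycentric_refinement G)
      (\<lambda>x. real (simplex_dim x)) \<omega> k g)"
    (is "?lhs = alternating_extension \<omega> ?dg")
proof
  fix l
  show "?lhs l = alternating_extension \<omega> ?dg l"
  proof (cases "l \<in> ordered_simplices G (Suc k)")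
    case True
    then have l: "distinct l" "length l = Suc (Suc k)" and s: "set l \<in> simplices G"
      by (auto simp: ordered_simplices_def)
    let ?F = "{y \<in> {s \<in> simplices G. card s = Suc k}. y \<subset> set l}"
    note faces = codimension_one_faces[OF l s]
    have summand: "(-1) ^ i * alternating_extension \<omega> g (take i l @ drop (Suc i) l) =
        orientation_sign (\<omega> (set l)) l *
          (incidence \<omega> (set l) (set l - {l ! i}) * g (set l - {l ! i}))"
      if i: "i < length l" for i
    proof -
      have "set l - {l ! i} \<in> simplices G" using bij_betwE[OF faces] i by auto
      note face = orientation_sign_face[OF \<omega>[OF s] l(1) i \<omega>[OF this]]
      have "distinct (take i l @ drop (Suc i) l)"
        using l(1) by (auto simp: set_take_disj_set_drop_if_distinct)
      then have "(-1) ^ i * alternating_extension \<omega> g (take i l @ drop (Suc i) l) =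
          ((-1) ^ i * orientation_sign (\<omega> (set l - {l ! i})) (take i l @ drop (Suc i) l)) *
            g (set l - {l ! i})"
        unfolding alternating_extension_def face(1) by simp
      then show ?thesis unfolding face(2) by simp
    qed
    have "?lhs l = (\<Sum>i<length l. orientation_sign (\<omega> (set l)) l *
        (incidence \<omega> (set l) (set l - {l ! i}) * g (set l - {l ! i})))"
      using True summand by (simp add: coboundary_def)
    also have "\<dots> = orientation_sign (\<omega> (set l)) l * (\<Sum>y\<in>?F. incidence \<omega> (set l) y * g y)"
      unfolding sum_distrib_left by (rule sum.reindex_bij_betw[OF faces])
    also have "(\<Sum>y\<in>?F. incidence \<omega> (set l) y * g y) = ?dg (set l)"
      using l s by (simp add: morse_derivative_def critical_points_dim distinct_card)
    finally show ?thesis using l(1) by (simp add: alternating_extension_def[of \<omega> ?dg l])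
  next
    case False
    then show ?thesis
      by (auto simp: coboundary_def alternating_extension_def morse_derivative_def
          critical_points_dim ordered_simplices_def distinct_card)
  qed
qed

theorem proposition5:
  fixes G :: "'v graph"
    and \<omega> :: "'v set \<Rightarrow> 'v list set"
    and m :: nat
  assumes "finite_simple_graph G"
    and "\<And>s. s \<in> simplices G \<Longrightarrow> is_orientation s (\<omega> s)"
  shows "isomorphic_real_spaces
           (morse_cohomology (barycentric_refinement G) (\<lambda>x. real (simplex_dim x)) \<omega> m)
           (simplicial_cohomology G m)"
  unfolding morse_cohomology_def simplicial_cohomology_def
proof (rule cohomology_isomorphic[where \<Psi> = "alternating_extension \<omega>"])
  show "bij_betw (alternating_extension \<omega>)
      (morse_cochains (barycentric_refinement G) (\<lambda>x. real (simplex_dim x)) k)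
      (simplicial_cochains G k)" for k
    unfolding morse_cochains_def critical_points_dim
    by (rule alternating_extension_bij[OF assms(2)])
  show "coboundary G k (alternating_extension \<omega> g) =
      alternating_extension \<omega> (morse_derivative (barycentric_refinement G)
        (\<lambda>x. real (simplex_dim x)) \<omega> k g)" for k g
    by (rule alternating_extension_derivative[OF assms(2)])
qed (auto simp: alternating_extension_def morse_cochains_def morse_derivative_def
      fun_eq_iff algebra_simps)

end
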